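(* Let $I\subseteq\mathbb{R}$ be an open interval, let $f:I\to I$ be a $C^3$ map, and let $n$ be a positive integer. Suppose that for every $x\in I$ such that $(f^{n+1})'(x)\neq 0$ and $(f^{n+1})''(x)=0$, both of the following inequalities hold: $$\frac{(f^n)'''(f(x))}{(f^n)'(f(x))}-\frac{3}{2}\left(\frac{(f^n)''(f(x))}{(f^n)'(f(x))}\right)^2<0 \qquad\text{and}\qquad \frac{f'''(x)}{f'(x)}-\frac{3}{2}\left(\frac{f''(x)}{f'(x)}\right)^2<0 .$$ Then the derivative $(f^{n+1})'$ satisfies the Minimum Principle on $I$.
   Context: Here $f^k$ denotes the $k$-th iterate of $f$ (composition of $f$ with itself $k$ times), and primes denote derivatives, so $(f^k)'$, $(f^k)''$, $(f^k)'''$ are the first three derivatives of the iterate $f^k$. A real-valued map $g$ defined on an interval $J=[a,b]$ satisfies the Minimum Principle on $J$ if $|g(x)|>\min\{|g(a)|,|g(b)|\}$ for all $x\in(a,b)$. A real-valued map $g$ defined on an interval $I$ satisfies the Minimum Principle (on $I$) if it satisfies the Minimum Principle on every interval $J=[a,b]\subset I$ (with $a<b$) on which $g$ does not vanish. *)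

theory Defs
  imports "HOL-Analysis.Analysis"
begin

text \<open>
  The class $C^k$ on an open set \<open>S\<close>. Since \<^const>\<open>deriv\<close> and \<open>at x\<close> are two-sided, this is the usual
  notion only for open \<open>S\<close>; there, the derivatives at points of \<open>S\<close> depend only on the
  restriction of \<open>f\<close> to \<open>S\<close>.
\<close>
definition Ck_on_open :: "nat \<Rightarrow> (real \<Rightarrow> real) \<Rightarrow> real set \<Rightarrow> bool" where
  "Ck_on_open k f S \<longleftrightarrow>
     open S \<and>
     (\<forall>j<k. \<forall>x\<in>S. (deriv ^^ j) f differentiable at x) \<and>
     continuous_on S ((deriv ^^ k) f)"

definition min_principle_on_Icc :: "(real \<Rightarrow> real) \<Rightarrow> real \<Rightarrow> real \<Rightarrow> bool" where
  "min_principle_on_Icc g a b \<longleftrightarrow>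
     (\<forall>x\<in>{a<..<b}. \<bar>g x\<bar> > min \<bar>g a\<bar> \<bar>g b\<bar>)"

definition min_principle :: "(real \<Rightarrow> real) \<Rightarrow> real set \<Rightarrow> bool" where
  "min_principle g I \<longleftrightarrow>
     (\<forall>a b. a < b \<longrightarrow> {a..b} \<subseteq> I \<longrightarrow> (\<forall>x\<in>{a..b}. g x \<noteq> 0) \<longrightarrow> min_principle_on_Icc g a b)"

end

theory Submission
  imports Defs
begin

text \<open>
  Write \<open>S f = f''' / f' - 3/2 (f'' / f')\<^sup>2\<close> for the Schwarzian derivative. It satisfies the cocycle
  rule \<open>S (g \<circ> f) = (S g \<circ> f) (f')\<^sup>2 + S f\<close>, so that, for \<open>F = f^(n+1) = f^n \<circ> f\<close>, the two
  hypotheses at a point \<open>x\<close> with \<open>F' x \<noteq> 0\<close> and \<open>F'' x = 0\<close> add up to \<open>S F x < 0\<close>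
  (lemma \<open>schwarzian_funpow_neg\<close>). Since \<open>F''\<close> vanishes
  there, this says that \<open>F'''\<close> and \<open>F'\<close> have opposite signs at \<open>x\<close>. Hence every critical point of
  \<open>F'\<close> at which \<open>F'\<close> does not vanish is a strict local maximum of \<open>\<bar>F'\<bar>\<close>.
  If the Minimum Principle failed on \<open>[a, b]\<close>, then \<open>\<bar>F'\<bar>\<close> would attain
  its minimum over \<open>[a, b]\<close> at an interior point, contradicting the second derivative test
  (lemma \<open>min_principle_if_second_deriv_opposite\<close>).
\<close>

section \<open>Iterated derivatives on open sets\<close>

definition times_differentiable_on :: "nat \<Rightarrow> (real \<Rightarrow> real) \<Rightarrow> real set \<Rightarrow> bool" where
  "times_differentiable_on k f S \<longleftrightarrow>
     (\<forall>j<k. \<forall>x\<in>S. ((deriv ^^ j) f has_real_derivative (deriv ^^ Suc j) f x) (at x))"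

lemma Ck_on_open_imp_times_differentiable_on:
  assumes "Ck_on_open k f S"
  shows "times_differentiable_on k f S"
  using assms
  by (auto simp: Ck_on_open_def times_differentiable_on_def DERIV_deriv_iff_real_differentiable)

text \<open>
  Openness of \<open>S\<close> is what allows an identity \<open>(deriv ^^ j) (h 0) = h j\<close>, valid only on \<open>S\<close>, to be
  differentiated.
\<close>
lemma higher_deriv_eqI:
  fixes h :: "nat \<Rightarrow> real \<Rightarrow> real"
  assumes "open S"
    and h: "\<And>j x. j < k \<Longrightarrow> x \<in> S \<Longrightarrow> (h j has_real_derivative h (Suc j) x) (at x)"
  shows "j \<le> k \<Longrightarrow> x \<in> S \<Longrightarrow> (deriv ^^ j) (h 0) x = h j x"
proof (induction j arbitrary: x)
  case 0
  then show ?case by simp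
next
  case (Suc j)
  have "((deriv ^^ j) (h 0) has_real_derivative h (Suc j) x) (at x)"
    by (rule has_field_derivative_transform_within_open[OF h \<open>open S\<close>]) (use Suc in auto)
  then show ?case by (simp add: DERIV_imp_deriv)
qed

lemma times_differentiable_onI:
  fixes h :: "nat \<Rightarrow> real \<Rightarrow> real"
  assumes "open S"
    and h: "\<And>j x. j < k \<Longrightarrow> x \<in> S \<Longrightarrow> (h j has_real_derivative h (Suc j) x) (at x)"
  shows "times_differentiable_on k (h 0) S"
  unfolding times_differentiable_on_def
proof (intro allI ballI impI)
  fix j x assume "j < k" "x \<in> S"
  have "((deriv ^^ j) (h 0) has_real_derivative h (Suc j) x) (at x)"
    by (rule has_field_derivative_transform_within_open[OF h \<open>open S\<close>])
       (use \<open>j < k\<close> \<open>x \<in> S\<close> higher_deriv_eqI[of S k h, OF assms] in auto)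
  then show "((deriv ^^ j) (h 0) has_real_derivative (deriv ^^ Suc j) (h 0) x) (at x)"
    using higher_deriv_eqI[of S k h "Suc j" x, OF assms] \<open>j < k\<close> \<open>x \<in> S\<close> by simp
qed

lemma
  assumes "open S" "f \<in> S \<rightarrow> T"
    and f: "times_differentiable_on 3 f S" and g: "times_differentiable_on 3 g T"
  shows times_differentiable_on_compose: "times_differentiable_on 3 (g \<circ> f) S"
    and deriv_compose: "x \<in> S \<Longrightarrow> deriv (g \<circ> f) x = deriv g (f x) * deriv f x"
    and deriv2_compose: "x \<in> S \<Longrightarrow> (deriv ^^ 2) (g \<circ> f) x =
      (deriv ^^ 2) g (f x) * (deriv f x)\<^sup>2 + deriv g (f x) * (deriv ^^ 2) f x"
    and deriv3_compose: "x \<in> S \<Longrightarrow> (deriv ^^ 3) (g \<circ> f) x =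
      (deriv ^^ 3) g (f x) * deriv f x ^ 3
      + 3 * (deriv ^^ 2) g (f x) * deriv f x * (deriv ^^ 2) f x
      + deriv g (f x) * (deriv ^^ 3) f x"
proof -
  define h :: "nat \<Rightarrow> real \<Rightarrow> real" where "h = (\<lambda>j x.
      if j = 0 then g (f x)
      else if j = 1 then deriv g (f x) * deriv f x
      else if j = 2 then (deriv ^^ 2) g (f x) * (deriv f x)\<^sup>2 + deriv g (f x) * (deriv ^^ 2) f x
      else (deriv ^^ 3) g (f x) * deriv f x ^ 3
        + 3 * (deriv ^^ 2) g (f x) * deriv f x * (deriv ^^ 2) f x
        + deriv g (f x) * (deriv ^^ 3) f x)"
  have f_derivs: "(f has_real_derivative deriv f x) (at x)"
      "(deriv f has_real_derivative (deriv ^^ 2) f x) (at x)"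
      "((deriv ^^ 2) f has_real_derivative (deriv ^^ 3) f x) (at x)" if "x \<in> S" for x
    using f[unfolded times_differentiable_on_def, rule_format, OF _ that, of 0]
      f[unfolded times_differentiable_on_def, rule_format, OF _ that, of 1]
      f[unfolded times_differentiable_on_def, rule_format, OF _ that, of 2]
    by (simp_all add: eval_nat_numeral)
  have g_derivs: "(g has_real_derivative deriv g y) (at y)"
      "(deriv g has_real_derivative (deriv ^^ 2) g y) (at y)"
      "((deriv ^^ 2) g has_real_derivative (deriv ^^ 3) g y) (at y)" if "y \<in> T" for y
    using g[unfolded times_differentiable_on_def, rule_format, OF _ that, of 0]
      g[unfolded times_differentiable_on_def, rule_format, OF _ that, of 1]
      g[unfolded times_differentiable_on_def, rule_format, OF _ that, of 2]
    by (simp_all add: eval_nat_numeral)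
  have h: "(h j has_real_derivative h (Suc j) x) (at x)" if "j < 3" "x \<in> S" for j x
  proof -
    have "f x \<in> T" using assms(2) \<open>x \<in> S\<close> by auto
    note fx = f_derivs(1)[OF \<open>x \<in> S\<close>]
    have gf: "((\<lambda>x. g (f x)) has_real_derivative deriv g (f x) * deriv f x) (at x)"
        "((\<lambda>x. deriv g (f x)) has_real_derivative (deriv ^^ 2) g (f x) * deriv f x) (at x)"
        "((\<lambda>x. (deriv ^^ 2) g (f x)) has_real_derivative (deriv ^^ 3) g (f x) * deriv f x) (at x)"
      using g_derivs[OF \<open>f x \<in> T\<close>] fx by (auto intro: DERIV_chain2)
    note d = f_derivs[OF \<open>x \<in> S\<close>] gf
    consider "j = 0" | "j = 1" | "j = 2" using \<open>j < 3\<close> by linarith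
    then show ?thesis
    proof cases
      case 1
      then show ?thesis by (auto simp: h_def intro!: d)
    next
      case 2
      then show ?thesis
        by (auto simp: h_def power2_eq_square algebra_simps intro!: derivative_eq_intros d)
    next
      case 3
      then show ?thesis
        by (auto simp: h_def power2_eq_square power3_eq_cube algebra_simps
            intro!: derivative_eq_intros d)
    qed
  qed
  have h0: "h 0 = g \<circ> f" by (auto simp: h_def)
  show "times_differentiable_on 3 (g \<circ> f) S"
    using times_differentiable_onI[of S 3 h, OF \<open>open S\<close> h] by (simp add: h0)
  show "deriv (g \<circ> f) x = deriv g (f x) * deriv f x" if "x \<in> S"
    using higher_deriv_eqI[of S 3 h 1 x, OF \<open>open S\<close> h] that
    unfolding h0 by (simp add: h_def)
  show "(deriv ^^ 2) (g \<circ> f) x =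
      (deriv ^^ 2) g (f x) * (deriv f x)\<^sup>2 + deriv g (f x) * (deriv ^^ 2) f x" if "x \<in> S"
    using higher_deriv_eqI[of S 3 h 2 x, OF \<open>open S\<close> h] that
    unfolding h0 by (simp add: h_def)
  show "(deriv ^^ 3) (g \<circ> f) x =
      (deriv ^^ 3) g (f x) * deriv f x ^ 3
      + 3 * (deriv ^^ 2) g (f x) * deriv f x * (deriv ^^ 2) f x
      + deriv g (f x) * (deriv ^^ 3) f x" if "x \<in> S"
    using higher_deriv_eqI[of S 3 h 3 x, OF \<open>open S\<close> h] that
    unfolding h0 by (simp add: h_def)
qed

lemma times_differentiable_on_funpow:
  assumes "open S" "f \<in> S \<rightarrow> S" "times_differentiable_on 3 f S"
  shows "times_differentiable_on 3 (f ^^ m) S"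
proof (induction m)
  case 0
  define h :: "nat \<Rightarrow> real \<Rightarrow> real"
    where "h = (\<lambda>j x. if j = 0 then x else if j = 1 then 1 else 0)"
  have "times_differentiable_on 3 (h 0) S"
    by (rule times_differentiable_onI[OF \<open>open S\<close>]) (auto simp: h_def)
  then show ?case by (simp add: h_def id_def)
next
  case (Suc m)
  then show ?case
    unfolding funpow_Suc_right
    by (rule times_differentiable_on_compose[OF assms])
qed

section \<open>The Schwarzian derivative\<close>

definition schwarzian :: "(real \<Rightarrow> real) \<Rightarrow> real \<Rightarrow> real" where
  "schwarzian f x =
     (deriv ^^ 3) f x / deriv f x - 3 / 2 * ((deriv ^^ 2) f x / deriv f x)\<^sup>2"

text \<open>
  With \<open>F = g \<circ> f\<close>, the quotient \<open>F''' / F'\<close> contributes the mixed term \<open>3 g'' f'' / g'\<close> and the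
  square \<open>(F'' / F')\<^sup>2\<close> contributes \<open>2 g'' f'' / g'\<close>, where \<open>g'\<close> and \<open>g''\<close> are taken at \<open>f x\<close>. The
  weight \<open>3/2\<close> makes them cancel.
\<close>
lemma schwarzian_compose:
  assumes "open S" "f \<in> S \<rightarrow> T" "times_differentiable_on 3 f S" "times_differentiable_on 3 g T"
    and "x \<in> S" "deriv f x \<noteq> 0" "deriv g (f x) \<noteq> 0"
  shows "schwarzian (g \<circ> f) x = schwarzian g (f x) * (deriv f x)\<^sup>2 + schwarzian f x"
proof -
  note compose = deriv_compose[OF assms(1-5)] deriv2_compose[OF assms(1-5)]
    deriv3_compose[OF assms(1-5)]
  show ?thesis
    using assms(6,7) unfolding schwarzian_def compose
    by (simp add: field_simps power2_eq_square power3_eq_cube)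
qed

lemma schwarzian_funpow_neg:
  assumes "open S" "f \<in> S \<rightarrow> S" "times_differentiable_on 3 f S" "x \<in> S"
    and "deriv (f ^^ (n + 1)) x \<noteq> 0"
    and "schwarzian (f ^^ n) (f x) < 0" "schwarzian f x < 0"
  shows "schwarzian (f ^^ (n + 1)) x < 0"
proof -
  have iter: "f ^^ (n + 1) = f ^^ n \<circ> f" by (simp add: funpow_Suc_right del: funpow.simps)
  have n: "times_differentiable_on 3 (f ^^ n) S"
    by (rule times_differentiable_on_funpow[OF assms(1-3)])
  have nz: "deriv f x \<noteq> 0" "deriv (f ^^ n) (f x) \<noteq> 0"
    using assms(5) unfolding iter deriv_compose[OF assms(1-3) n assms(4)] by auto
  have "schwarzian (f ^^ n) (f x) * (deriv f x)\<^sup>2 < 0"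
    using assms(6) nz by (simp add: mult_neg_pos)
  then show ?thesis
    using assms(7) unfolding iter schwarzian_compose[OF assms(1-3) n assms(4) nz] by linarith
qed

section \<open>Minima and the second derivative\<close>

text \<open>
  Just to the right of a critical point with negative second derivative the first derivative is
  negative, so the function drops below its value there.
\<close>
lemma second_deriv_neg_not_min:
  fixes g :: "real \<Rightarrow> real"
  assumes "x \<in> {a<..<b}"
    and g': "\<And>y. y \<in> {a<..<b} \<Longrightarrow> (g has_real_derivative g' y) (at y)"
    and g'': "(g' has_real_derivative d) (at x)"
    and "g' x = 0" "d < 0"
  shows "\<exists>y\<in>{a<..<b}. g y < g x"
proof -
  obtain e where "e > 0" and e: "\<And>h. h > 0 \<Longrightarrow> h < e \<Longrightarrow> g' (x + h) < 0"
    using DERIV_neg_dec_right[OF g'' \<open>d < 0\<close>] \<open>g' x = 0\<close> by auto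
  define y where "y = x + min e (b - x) / 2"
  have y: "x < y" "y < b" "y < x + e"
    using \<open>e > 0\<close> assms(1) by (auto simp: y_def min_def field_simps)
  obtain z where z: "x < z" "z < y" and eq: "g y - g x = (y - x) * g' z"
    using MVT2[OF \<open>x < y\<close>, of g g'] g' assms(1) y by fastforce
  have "g' z < 0"
    using e[of "z - x"] z y by simp
  then have "(y - x) * g' z < 0"
    using y by (simp add: mult_pos_neg)
  then have "g y < g x"
    using eq by linarith
  then show ?thesis
    using y assms(1) by auto
qed

text \<open>
  The extrema of \<open>\<bar>g\<bar>\<close> are studied through \<open>s g\<close>, where \<open>s = \<plusminus>1\<close> is the constant sign of \<open>g\<close> on the
  interval, because \<open>\<bar>g\<bar>\<close> itself is not given as a differentiable function.
\<close>
lemma min_principle_if_second_deriv_opposite: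
  fixes g :: "real \<Rightarrow> real"
  assumes g': "\<And>x. x \<in> I \<Longrightarrow> (g has_real_derivative g' x) (at x)"
    and g'': "\<And>x. x \<in> I \<Longrightarrow> (g' has_real_derivative g'' x) (at x)"
    and opposite: "\<And>x. x \<in> I \<Longrightarrow> g x \<noteq> 0 \<Longrightarrow> g' x = 0 \<Longrightarrow> g'' x / g x < 0"
  shows "min_principle g I"
  unfolding min_principle_def min_principle_on_Icc_def
proof (intro allI impI ballI)
  fix a b x :: real
  assume "a < b" and sub: "{a..b} \<subseteq> I" and nz: "\<forall>x\<in>{a..b}. g x \<noteq> 0" and x: "x \<in> {a<..<b}"
  show "min \<bar>g a\<bar> \<bar>g b\<bar> < \<bar>g x\<bar>"
  proof (rule ccontr)
    assume low: "\<not> min \<bar>g a\<bar> \<bar>g b\<bar> < \<bar>g x\<bar>"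
    have cont: "continuous_on {a..b} g"
      using g' sub by (meson DERIV_isCont continuous_at_imp_continuous_on subsetD)
    define s where "s = sgn (g x)"
    have s: "\<bar>g y\<bar> = s * g y" if "y \<in> {a..b}" for y
    proof -
      have "connected (g ` {a..b})"
        by (intro connected_continuous_image cont) auto
      then have "0 \<in> g ` {a..b}" if "u \<in> g ` {a..b}" "v \<in> g ` {a..b}" "u \<le> 0" "0 \<le> v" for u v
        using that unfolding connected_iff_interval by blast
      moreover have "0 \<notin> g ` {a..b}" "g x \<in> g ` {a..b}" "g y \<in> g ` {a..b}"
        using nz x that by auto
      ultimately have "sgn (g y) = sgn (g x)"
        by (metis linorder_le_cases order_antisym_conv linorder_not_le sgn_pos sgn_neg)
      then show ?thesis by (metis abs_sgn s_def mult.commute)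
    qed
    obtain m where m: "m \<in> {a..b}" and min: "\<And>y. y \<in> {a..b} \<Longrightarrow> s * g m \<le> s * g y"
      using continuous_attains_inf[of "{a..b}" "\<lambda>y. s * g y"] \<open>a < b\<close>
        continuous_on_mult_left[OF cont] by force
    \<comment> \<open>As \<open>\<bar>g x\<bar>\<close> is at most both endpoint values, a minimum at an endpoint is also attained at \<open>x\<close>.\<close>
    obtain z where z: "z \<in> {a<..<b}" and zmin: "\<And>y. y \<in> {a..b} \<Longrightarrow> s * g z \<le> s * g y"
    proof (cases "m \<in> {a<..<b}")
      case True
      then show ?thesis using that min by blast
    next
      case False
      then have "m = a \<or> m = b" using m by auto
      then have "s * g x \<le> s * g m"
        using low s[of x] s[of a] s[of b] min[of a] min[of b] x \<open>a < b\<close> by auto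
      then show ?thesis using that[OF x] min by force
    qed
    have zI: "z \<in> I" and "z \<in> {a..b}" using z sub by auto
    have D: "((\<lambda>y. s * g y) has_real_derivative s * g' y) (at y)" if "y \<in> {a<..<b}" for y
      using that sub by (intro DERIV_cmult g') auto
    have "s * g' z = 0"
      using DERIV_local_min[OF D[OF z], of "min (z - a) (b - z)"] z zmin by (auto simp: abs_if split: if_splits)
    moreover have "s * g z > 0" "s \<noteq> 0"
      using s[OF \<open>z \<in> {a..b}\<close>] nz \<open>z \<in> {a..b}\<close> by (force, metis zero_less_abs_iff mult_zero_left less_irrefl)
    ultimately have "g'' z / g z < 0"
      using opposite[OF zI] nz \<open>z \<in> {a..b}\<close> by auto
    then have "s * g'' z < 0"
      using \<open>s * g z > 0\<close> by (auto simp: zero_less_mult_iff mult_less_0_iff divide_less_0_iff)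
    then obtain y where "y \<in> {a<..<b}" "s * g y < s * g z"
      using second_deriv_neg_not_min[OF z D DERIV_cmult[OF g''[OF zI]] \<open>s * g' z = 0\<close>] by blast
    then show False using zmin[of y] by auto
  qed
qed

section \<open>The Minimum Principle for iterates\<close>

theorem mainTheorem1:
  fixes I :: "real set" and f :: "real \<Rightarrow> real" and n :: nat
  assumes "open I" and "is_interval I"
    and "f \<in> I \<rightarrow> I"
    and "Ck_on_open 3 f I"
    and "n > 0"
    and "\<And>x. x \<in> I \<Longrightarrow> deriv (f ^^ (n + 1)) x \<noteq> 0 \<Longrightarrow> (deriv ^^ 2) (f ^^ (n + 1)) x = 0 \<Longrightarrow>
           (deriv ^^ 3) (f ^^ n) (f x) / deriv (f ^^ n) (f x)
             - 3 / 2 * ((deriv ^^ 2) (f ^^ n) (f x) / deriv (f ^^ n) (f x))\<^sup>2 < 0 \<and>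
           (deriv ^^ 3) f x / deriv f x
             - 3 / 2 * ((deriv ^^ 2) f x / deriv f x)\<^sup>2 < 0"
  shows "min_principle (deriv (f ^^ (n + 1))) I"
proof -
  let ?F = "f ^^ (n + 1)"
  have f: "times_differentiable_on 3 f I"
    by (rule Ck_on_open_imp_times_differentiable_on[OF assms(4)])
  have F: "times_differentiable_on 3 ?F I"
    by (rule times_differentiable_on_funpow[OF assms(1,3) f])
  show ?thesis
  proof (rule min_principle_if_second_deriv_opposite)
    fix x assume "x \<in> I"
    show "(deriv ?F has_real_derivative (deriv ^^ 2) ?F x) (at x)"
      using F[unfolded times_differentiable_on_def, rule_format, of 1, OF _ \<open>x \<in> I\<close>]
      by (simp add: eval_nat_numeral)
    show "((deriv ^^ 2) ?F has_real_derivative (deriv ^^ 3) ?F x) (at x)"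
      using F[unfolded times_differentiable_on_def, rule_format, of 2, OF _ \<open>x \<in> I\<close>]
      by (simp add: eval_nat_numeral)
  next
    fix x assume "x \<in> I" and nz: "deriv ?F x \<noteq> 0" and crit: "(deriv ^^ 2) ?F x = 0"
    have "schwarzian ?F x < 0"
      using schwarzian_funpow_neg[OF assms(1,3) f \<open>x \<in> I\<close> nz] assms(6)[OF \<open>x \<in> I\<close> nz crit]
      by (simp only: schwarzian_def)
    then show "(deriv ^^ 3) ?F x / deriv ?F x < 0"
      unfolding schwarzian_def crit by simp
  qed
qed

end
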